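(* Let $f_{xxx}$ be a ternary cubic form over $\mathbb{C}$. The following are equivalent: (1) $\theta_{uuxx}=0$ and $f_{xxx}\neq 0$. (2) $f_{xxx}=a_x^3$ for some nonzero linear form $a_x$. (3) $\operatorname{rank}[f_{xxx}]=1$.
   Context: All forms are homogeneous polynomials with complex coefficients in $x_1,x_2,x_3$ (the zero polynomial is allowed); subscripts indicate degree, so $a_x=a_1x_1+a_2x_2+a_3x_3$ is a linear form and $f_{xxx}$ a cubic form. Let $u_1,u_2,u_3$ be further independent variables and $u_x=u_1x_1+u_2x_2+u_3x_3$. Rank: for a form $f$ of degree $d$, $\operatorname{rank}[f]$ (Waring rank) is the smallest integer $r\ge 0$ such that $f$ is a sum of $r$ $d$-th powers of linear forms in $\mathbb{C}[x_1,x_2,x_3]$. Transvectants: for forms $f,g,h$ in $x_1,x_2,x_3$ (whose coefficients may be polynomials in $u_1,u_2,u_3$, treated as constants), $\mathcal{J}_n[f,g,h]$ is obtained by applying $\Omega^n$ to $f(x)g(y)h(z)$, where $x,y,z$ are three independent triples of variables and $\Omega$ is the differential operator given by the $3\times 3$ determinant with rows $(\partial/\partial x_i)_i$, $(\partial/\partial y_i)_i$, $(\partial/\partial z_i)_i$, and then setting $y=z=x$. (For $n=1$ this is the Jacobian determinant.) Concomitant: $\theta_{uuxx}=\frac14\mathcal{J}_2[f_{xxx},f_{xxx},u_x^2]$, a polynomial in $x_1,x_2,x_3,u_1,u_2,u_3$. The condition $\theta_{uuxx}=0$ means it vanishes identically. *)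

theory Defs
  imports Complex_Main "HOL-Library.Poly_Mapping" "HOL-Library.Numeral_Type"
    "HOL-Combinatorics.Permutations"
begin

text \<open>
  Polynomials in variables indexed by \<open>'v\<close>, with coefficients in \<open>'a\<close>: finitely supported maps
  from monomials (exponent vectors) to coefficients. The ring structure is the convolution product
  of \<^theory>\<open>HOL-Library.Poly_Mapping\<close>.
\<close>

type_synonym ('v, 'a) mpoly = "('v \<Rightarrow>\<^sub>0 nat) \<Rightarrow>\<^sub>0 'a"

definition Const :: "'a::zero \<Rightarrow> ('v, 'a) mpoly" where
  "Const c = Poly_Mapping.single 0 c"

definition Var :: "'v \<Rightarrow> ('v, 'a::zero_neq_one) mpoly" where
  "Var v = Poly_Mapping.single (Poly_Mapping.single v 1) 1"

definition subst :: "('v \<Rightarrow> ('w, 'a::comm_ring_1) mpoly) \<Rightarrow> ('v, 'a) mpoly \<Rightarrow> ('w, 'a) mpoly" where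
  "subst \<sigma> p = (\<Sum>m\<in>Poly_Mapping.keys p.
     Const (Poly_Mapping.lookup p m) *
     (\<Prod>v\<in>Poly_Mapping.keys m. \<sigma> v ^ Poly_Mapping.lookup m v))"

text \<open>
  In \<open>partial_deriv\<close>, a monomial not containing \<open>v\<close> contributes coefficient \<open>0\<close>, so the truncated
  subtraction of exponents is harmless.
\<close>

definition partial_deriv :: "'v \<Rightarrow> ('v, 'a::comm_ring_1) mpoly \<Rightarrow> ('v, 'a) mpoly" where
  "partial_deriv v p = (\<Sum>m\<in>Poly_Mapping.keys p.
     Poly_Mapping.single (m - Poly_Mapping.single v 1)
       (of_nat (Poly_Mapping.lookup m v) * Poly_Mapping.lookup p m))"

text \<open>
  Ternary polynomials are indexed by the three-element type \<open>3\<close>, whose elements are \<open>1\<close>, \<open>2\<close> and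
  \<open>3\<close> (with \<open>3 = 0\<close>). The zero polynomial is a form of every degree.
\<close>

definition is_form :: "nat \<Rightarrow> (3, 'a::zero) mpoly \<Rightarrow> bool" where
  "is_form d p \<longleftrightarrow> (\<forall>m\<in>Poly_Mapping.keys p. (\<Sum>i\<in>UNIV. Poly_Mapping.lookup m i) = d)"

text \<open>
  The degree is an argument of the rank because the zero polynomial does not determine it.
\<close>

definition waring_rank :: "nat \<Rightarrow> (3, complex) mpoly \<Rightarrow> nat" where
  "waring_rank d f = (LEAST r. \<exists>l :: nat \<Rightarrow> (3, complex) mpoly.
     (\<forall>i<r. is_form 1 (l i)) \<and> f = (\<Sum>i<r. l i ^ d))"

datatype xyz = X "3" | Y "3" | Z "3"

text \<open>
  The determinant with rows \<open>\<partial>/\<partial>x\<close>, \<open>\<partial>/\<partial>y\<close>, \<open>\<partial>/\<partial>z\<close>, expanded by the Leibniz formula.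
\<close>

definition Omega :: "(xyz, 'a::comm_ring_1) mpoly \<Rightarrow> (xyz, 'a) mpoly" where
  "Omega F = (\<Sum>p | p permutes (UNIV :: 3 set).
     of_int (sign p) *
       partial_deriv (X (p 1)) (partial_deriv (Y (p 2)) (partial_deriv (Z (p 3)) F)))"

definition transvectant ::
  "nat \<Rightarrow> (3, 'a::comm_ring_1) mpoly \<Rightarrow> (3, 'a) mpoly \<Rightarrow> (3, 'a) mpoly \<Rightarrow> (3, 'a) mpoly" where
  "transvectant n f g h =
     subst (\<lambda>v. case v of X i \<Rightarrow> Var i | Y i \<Rightarrow> Var i | Z i \<Rightarrow> Var i)
       ((Omega ^^ n) (subst (\<lambda>i. Var (X i)) f * subst (\<lambda>i. Var (Y i)) g * subst (\<lambda>i. Var (Z i)) h))"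

text \<open>
  Polynomials in \<open>x\<close> and \<open>u\<close> are polynomials in \<open>x\<close> whose coefficients are polynomials in \<open>u\<close>.
  In \<open>u_x\<close> the inner \<open>Var i\<close> is the coefficient \<open>u\<^sub>i\<close> and the outer one is the variable \<open>x\<^sub>i\<close>.
\<close>

definition u_x :: "(3, (3, complex) mpoly) mpoly" where
  "u_x = (\<Sum>i\<in>UNIV. Const (Var i) * Var i)"

definition theta :: "(3, complex) mpoly \<Rightarrow> (3, (3, complex) mpoly) mpoly" where
  "theta f = Const (Const (1/4)) *
     transvectant 2 (Poly_Mapping.map Const f) (Poly_Mapping.map Const f) (u_x ^ 2)"

end

theory Submission
  imports Defs "HOL-Analysis.Cartesian_Space"
begin

text \<open>
  The concomitant \<open>\<theta>\<close> is the adjugate of the Hessian of \<open>f\<close>, viewed as a quadratic form in \<open>u\<close>; it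
  vanishes identically iff the Hessian has rank at most one everywhere.
  This is clear for a cube. Conversely, let \<open>T\<close> be the symmetric trilinear form with
  \<open>f(x) = T(x, x, x)\<close>. Substituting \<open>u = a \<times> b\<close> turns \<open>\<theta> = 0\<close> into
  \<open>T(v, a, a) T(v, b, b) = T(v, a, b)\<^sup>2\<close>. If \<open>f \<noteq> 0\<close>, some \<open>v\<close> can be scaled to \<open>T(v, v, v) = 1\<close>, and comparing
  this identity at \<open>v\<close>, \<open>y\<close> and \<open>v + y\<close> yields \<open>f(y) = T(v, v, y)\<^sup>3\<close>.
\<close>

subsection \<open>Evaluation of polynomials\<close>

lemma poly_mapping_sum_single:
  fixes p :: "'k \<Rightarrow>\<^sub>0 'a::comm_monoid_add"
  shows "p = (\<Sum>k\<in>Poly_Mapping.keys p. Poly_Mapping.single k (Poly_Mapping.lookup p k))"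
proof (rule poly_mapping_eqI)
  fix k
  show "Poly_Mapping.lookup p k =
      Poly_Mapping.lookup (\<Sum>k\<in>Poly_Mapping.keys p. Poly_Mapping.single k (Poly_Mapping.lookup p k)) k"
    by (simp add: lookup_sum lookup_single when_def sum.delta' in_keys_iff)
qed

text \<open>Every finitely supported map is a finite sum of singles; the zero map arises as a single
  with coefficient 0.\<close>

lemma poly_mapping_single_induct [case_names single add]:
  fixes p :: "'k \<Rightarrow>\<^sub>0 'a::comm_monoid_add"
  assumes single: "\<And>k c. P (Poly_Mapping.single k c)"
    and add: "\<And>p q. P p \<Longrightarrow> P q \<Longrightarrow> P (p + q)"
  shows "P p"
proof -
  have "P (\<Sum>k\<in>A. Poly_Mapping.single k (Poly_Mapping.lookup p k))" if "finite A" for A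
    using that
  proof (induction A rule: finite_induct)
    case empty
    show ?case using single[of undefined 0] by simp
  next
    case (insert k A)
    then show ?case by (simp add: single add)
  qed
  from this[OF finite_keys[of p]] show ?thesis
    by (simp flip: poly_mapping_sum_single)
qed

text \<open>All three sums may run over the union of the supports because \<open>g k 0 = 0\<close>;
  this absorbs cancellation in \<open>p + q\<close>.\<close>

lemma sum_keys_add:
  fixes p q :: "'k \<Rightarrow>\<^sub>0 'a::comm_monoid_add" and g :: "'k \<Rightarrow> 'a \<Rightarrow> 'b::comm_monoid_add"
  assumes zero: "\<And>k. g k 0 = 0" and add: "\<And>k a b. g k (a + b) = g k a + g k b"
  shows "(\<Sum>k\<in>Poly_Mapping.keys (p + q). g k (Poly_Mapping.lookup (p + q) k)) =
    (\<Sum>k\<in>Poly_Mapping.keys p. g k (Poly_Mapping.lookup p k)) +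
    (\<Sum>k\<in>Poly_Mapping.keys q. g k (Poly_Mapping.lookup q k))"
proof -
  let ?A = "Poly_Mapping.keys p \<union> Poly_Mapping.keys q"
  have *: "(\<Sum>k\<in>Poly_Mapping.keys r. g k (Poly_Mapping.lookup r k)) =
      (\<Sum>k\<in>?A. g k (Poly_Mapping.lookup r k))" if "Poly_Mapping.keys r \<subseteq> ?A" for r
    by (rule sum.mono_neutral_left) (use that in \<open>auto simp: in_keys_iff zero\<close>)
  show ?thesis
    using keys_add[of p q] by (subst (1 2 3) *) (auto simp: lookup_add add sum.distrib)
qed

lemma Const_0 [simp]: "Const 0 = 0"
  and Const_1 [simp]: "Const 1 = 1"
  by (simp_all add: Const_def)

lemma Const_add: "Const (a + b) = Const a + Const b"
  for a b :: "'a::comm_ring_1"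
  by (simp add: Const_def single_add)

lemma Const_mult: "Const (a * b) = Const a * Const b"
  for a b :: "'a::comm_ring_1"
  by (simp add: Const_def mult_single)

lemma single_eq_Const_mult:
  "Poly_Mapping.single m c = Const c * (Poly_Mapping.single m 1 :: ('v, 'a::comm_ring_1) mpoly)"
  by (simp add: Const_def mult_single)

lemma single_single_eq_Var_power:
  "Poly_Mapping.single (Poly_Mapping.single v n) 1 = (Var v ^ n :: ('v, 'a::comm_ring_1) mpoly)"
proof (induction n)
  case (Suc n)
  have "Poly_Mapping.single (Poly_Mapping.single v (Suc n)) 1 =
      Poly_Mapping.single (Poly_Mapping.single v 1) 1 *
      (Poly_Mapping.single (Poly_Mapping.single v n) 1 :: ('v, 'a) mpoly)"
    by (simp add: mult_single flip: single_add)
  with Suc show ?case by (simp add: Var_def)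
qed simp

text \<open>Constants and variables generate the polynomial ring, so claims stable under sums and
  products need checking only on them.\<close>

lemma mpoly_induct [case_names Const Var add mult]:
  fixes p :: "('v, 'a::comm_ring_1) mpoly"
  assumes Const: "\<And>c. P (Const c)" and Var: "\<And>v. P (Var v)"
    and add: "\<And>p q. P p \<Longrightarrow> P q \<Longrightarrow> P (p + q)"
    and mult: "\<And>p q. P p \<Longrightarrow> P q \<Longrightarrow> P (p * q)"
  shows "P p"
proof (induction p rule: poly_mapping_single_induct)
  case (single m c)
  have pow: "P (Var v ^ n)" for v n
  proof (induction n)
    case 0
    show ?case using Const[of 1] by simp
  qed (simp add: Var mult)
  have "P (Poly_Mapping.single m 1)"
  proof (induction m rule: poly_mapping_single_induct)
    case (single v n)
    show ?case by (simp only: single_single_eq_Var_power pow)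
  next
    case (add m n)
    then have "P (Poly_Mapping.single m 1 * Poly_Mapping.single n 1)" by (rule mult)
    then show ?case by (simp add: mult_single)
  qed
  then show ?case by (subst single_eq_Const_mult) (intro mult Const)
qed (rule add)

section \<open>Homomorphisms of commutative rings\<close>

locale comm_ring_hom =
  fixes \<phi> :: "'a::comm_ring_1 \<Rightarrow> 'b::comm_ring_1"
  assumes hom_1 [simp]: "\<phi> 1 = 1"
    and hom_add [simp]: "\<phi> (x + y) = \<phi> x + \<phi> y"
    and hom_mult [simp]: "\<phi> (x * y) = \<phi> x * \<phi> y"
begin

lemma hom_0 [simp]: "\<phi> 0 = 0"
  using hom_add[of 0 0] by (simp del: hom_add)

lemma hom_minus [simp]: "\<phi> (- x) = - \<phi> x"
  using hom_add[of x "- x"] by (simp del: hom_add add: eq_neg_iff_add_eq_0 add.commute)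

lemma hom_diff [simp]: "\<phi> (x - y) = \<phi> x - \<phi> y"
  using hom_add[of x "- y"] by (simp del: hom_add)

lemma hom_power [simp]: "\<phi> (x ^ n) = \<phi> x ^ n"
  by (induction n) simp_all

lemma hom_sum: "\<phi> (sum g A) = (\<Sum>x\<in>A. \<phi> (g x))"
  by (induction A rule: infinite_finite_induct) simp_all

lemma hom_of_nat [simp]: "\<phi> (of_nat n) = of_nat n"
  by (induction n) simp_all

lemma hom_numeral [simp]: "\<phi> (numeral n) = numeral n"
  using hom_of_nat[of "numeral n"] by (simp del: hom_of_nat)

end

lemma comm_ring_hom_id: "comm_ring_hom (\<lambda>x. x)"
  by unfold_locales simp_all

lemma comm_ring_hom_comp:
  "comm_ring_hom \<phi> \<Longrightarrow> comm_ring_hom \<psi> \<Longrightarrow> comm_ring_hom (\<lambda>x. \<psi> (\<phi> x))"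
  by (simp add: comm_ring_hom_def)

lemma comm_ring_hom_Const: "comm_ring_hom Const"
  by unfold_locales (simp_all add: Const_add Const_mult)

lemma comm_ring_hom_Const_Const: "comm_ring_hom (\<lambda>c. Const (Const c))"
  by (rule comm_ring_hom_comp) (rule comm_ring_hom_Const)+

interpretation Const: comm_ring_hom Const
  by (rule comm_ring_hom_Const)

lemma mpoly_hom_eq:
  fixes p :: "('v, 'a::comm_ring_1) mpoly"
  assumes "comm_ring_hom \<phi>" "comm_ring_hom \<psi>"
    and "\<And>c. \<phi> (Const c) = \<psi> (Const c)" "\<And>v. \<phi> (Var v) = \<psi> (Var v)"
  shows "\<phi> p = \<psi> p"
proof -
  interpret \<phi>: comm_ring_hom \<phi> by fact
  interpret \<psi>: comm_ring_hom \<psi> by fact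
  show ?thesis by (induction p rule: mpoly_induct) (simp_all add: assms)
qed

text \<open>The separate coefficient map \<open>\<phi>\<close> lets one construction cover
  \<open>subst\<close>, the embedding of coefficients, numerical evaluation, and evaluation in both
  \<open>x\<close> and \<open>u\<close>.\<close>

definition mpoly_eval ::
    "('a \<Rightarrow> 'b) \<Rightarrow> ('v \<Rightarrow> 'b) \<Rightarrow> ('v, 'a::comm_ring_1) mpoly \<Rightarrow> 'b::comm_ring_1" where
  "mpoly_eval \<phi> \<sigma> p = (\<Sum>m\<in>Poly_Mapping.keys p.
     \<phi> (Poly_Mapping.lookup p m) *
     (\<Prod>v\<in>Poly_Mapping.keys m. \<sigma> v ^ Poly_Mapping.lookup m v))"

context
  fixes \<phi> :: "'a::comm_ring_1 \<Rightarrow> 'b::comm_ring_1"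
  assumes hom: "comm_ring_hom \<phi>"
begin

interpretation comm_ring_hom \<phi> by (rule hom)

lemma mpoly_eval_single:
  "mpoly_eval \<phi> \<sigma> (Poly_Mapping.single m c) =
    \<phi> c * (\<Prod>v\<in>Poly_Mapping.keys m. \<sigma> v ^ Poly_Mapping.lookup m v)"
  by (simp add: mpoly_eval_def)

lemma mpoly_eval_Const: "mpoly_eval \<phi> \<sigma> (Const c) = \<phi> c"
  by (simp add: Const_def mpoly_eval_single)

lemma mpoly_eval_Var: "mpoly_eval \<phi> \<sigma> (Var v) = \<sigma> v"
  by (simp add: Var_def mpoly_eval_single)

lemma mpoly_eval_add: "mpoly_eval \<phi> \<sigma> (p + q) = mpoly_eval \<phi> \<sigma> p + mpoly_eval \<phi> \<sigma> q"
  unfolding mpoly_eval_def by (rule sum_keys_add) (simp_all add: algebra_simps)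

lemma monomial_value_add:
  "(\<Prod>v\<in>Poly_Mapping.keys (m + n). \<sigma> v ^ Poly_Mapping.lookup (m + n) v) =
    (\<Prod>v\<in>Poly_Mapping.keys m. \<sigma> v ^ Poly_Mapping.lookup m v) *
    (\<Prod>v\<in>Poly_Mapping.keys n. \<sigma> v ^ Poly_Mapping.lookup n v)"
  for \<sigma> :: "'v \<Rightarrow> 'b"
proof -
  let ?A = "Poly_Mapping.keys m \<union> Poly_Mapping.keys n"
  have *: "(\<Prod>v\<in>Poly_Mapping.keys k. \<sigma> v ^ Poly_Mapping.lookup k v) =
      (\<Prod>v\<in>?A. \<sigma> v ^ Poly_Mapping.lookup k v)" if "Poly_Mapping.keys k \<subseteq> ?A" for k
    by (rule prod.mono_neutral_left) (use that in \<open>auto simp: in_keys_iff\<close>)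
  show ?thesis
    using keys_add[of m n] by (subst (1 2 3) *) (auto simp: lookup_add power_add prod.distrib)
qed

lemma mpoly_eval_mult: "mpoly_eval \<phi> \<sigma> (p * q) = mpoly_eval \<phi> \<sigma> p * mpoly_eval \<phi> \<sigma> q"
proof (induction p rule: poly_mapping_single_induct)
  case (single m c)
  show ?case
  proof (induction q rule: poly_mapping_single_induct)
    case (single n d)
    show ?case by (simp add: mult_single mpoly_eval_single monomial_value_add)
  qed (simp add: algebra_simps mpoly_eval_add)
qed (simp add: algebra_simps mpoly_eval_add)

lemma comm_ring_hom_mpoly_eval: "comm_ring_hom (mpoly_eval \<phi> \<sigma>)"
proof
  show "mpoly_eval \<phi> \<sigma> 1 = 1"
    using mpoly_eval_Const[of \<sigma> 1] by simp
qed (simp_all add: mpoly_eval_add mpoly_eval_mult)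

end

lemma subst_eq_mpoly_eval: "subst = mpoly_eval Const"
  by (intro ext) (simp add: subst_def mpoly_eval_def)

interpretation subst: comm_ring_hom "subst \<sigma>" for \<sigma>
  unfolding subst_eq_mpoly_eval by (intro comm_ring_hom_mpoly_eval comm_ring_hom_Const)

lemma subst_Const [simp]: "subst \<sigma> (Const c) = Const c"
  and subst_Var [simp]: "subst \<sigma> (Var v) = \<sigma> v"
  by (simp_all add: subst_eq_mpoly_eval mpoly_eval_Const mpoly_eval_Var comm_ring_hom_Const)

lemma subst_subst_Var:
  assumes "\<And>v. \<tau> (j v) = Var v"
  shows "subst \<tau> (subst (\<lambda>v. Var (j v)) p) = p"
  by (induction p rule: mpoly_induct) (simp_all add: assms)

lemma single_1_eq_prod_Var:
  "(Poly_Mapping.single m 1 :: ('v, 'a::comm_ring_1) mpoly) =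
    (\<Prod>v\<in>Poly_Mapping.keys m. Var v ^ Poly_Mapping.lookup m v)"
proof (induction m rule: poly_mapping_single_induct)
  case (single v n)
  show ?case by (simp add: single_single_eq_Var_power)
next
  case (add m n)
  have "(Poly_Mapping.single (m + n) 1 :: ('v, 'a) mpoly) =
      Poly_Mapping.single m 1 * Poly_Mapping.single n 1"
    by (simp add: mult_single)
  with add show ?case
    by (simp add: monomial_value_add[OF comm_ring_hom_id])
qed

text \<open>Recognizing the coefficient embedding in \<open>theta\<close> as an evaluation makes it
  a ring homomorphism.\<close>

lemma map_Const_eq_mpoly_eval:
  "(Poly_Mapping.map Const p :: ('v, ('w, 'a::comm_ring_1) mpoly) mpoly) =
    mpoly_eval (\<lambda>c. Const (Const c)) Var p"
proof (induction p rule: poly_mapping_single_induct)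
  case (single m c)
  have "Poly_Mapping.map Const (Poly_Mapping.single m c) =
      (Poly_Mapping.single m (Const c) :: ('v, ('w, 'a) mpoly) mpoly)"
    by (simp add: when_def)
  then show ?case
    by (simp add: mpoly_eval_single comm_ring_hom_Const_Const
        single_eq_Const_mult[of m "Const c"] single_1_eq_prod_Var)
next
  case (add p q)
  have "Poly_Mapping.lookup (Poly_Mapping.map Const r) k =
      (Const (Poly_Mapping.lookup r k) :: ('w, 'a) mpoly)" for r :: "('v, 'a) mpoly" and k
    by (simp add: map.rep_eq when_def)
  then have "(Poly_Mapping.map Const (p + q) :: ('v, ('w, 'a) mpoly) mpoly) =
      Poly_Mapping.map Const p + Poly_Mapping.map Const q"
    by (intro poly_mapping_eqI) (simp add: lookup_add)
  with add show ?case
    by (simp add: mpoly_eval_add comm_ring_hom_Const_Const)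
qed

interpretation map_Const: comm_ring_hom
    "Poly_Mapping.map Const :: ('v, 'a::comm_ring_1) mpoly \<Rightarrow> ('v, ('w, 'a) mpoly) mpoly"
  unfolding map_Const_eq_mpoly_eval[abs_def]
  by (intro comm_ring_hom_mpoly_eval comm_ring_hom_Const_Const)

lemma map_Const_Const [simp]:
    "Poly_Mapping.map Const (Const c :: ('v, 'a) mpoly) = Const (Const c :: ('w, 'a) mpoly)"
  and map_Const_Var [simp]:
    "Poly_Mapping.map Const (Var v :: ('v, 'a) mpoly) = (Var v :: ('v, ('w, 'a) mpoly) mpoly)"
  for c :: "'a::comm_ring_1"
  by (simp_all add: map_Const_eq_mpoly_eval mpoly_eval_Const mpoly_eval_Var comm_ring_hom_Const_Const)

subsection \<open>Partial derivatives\<close>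

lemma partial_deriv_single:
  "partial_deriv v (Poly_Mapping.single m c) =
    Poly_Mapping.single (m - Poly_Mapping.single v 1) (of_nat (Poly_Mapping.lookup m v) * c)"
  by (simp add: partial_deriv_def)

lemma partial_deriv_add [simp]: "partial_deriv v (p + q) = partial_deriv v p + partial_deriv v q"
  unfolding partial_deriv_def by (rule sum_keys_add) (simp_all add: algebra_simps single_add)

lemma partial_deriv_Const [simp]: "partial_deriv v (Const c) = 0"
  by (simp add: Const_def partial_deriv_single)

lemma partial_deriv_Var: "partial_deriv v (Var w) = (if v = w then 1 else 0)"
  by (simp add: Var_def partial_deriv_single lookup_single when_def)

text \<open>Truncated subtraction at \<open>v\<close> can be moved past \<open>n\<close> when
  \<open>v\<close> occurs in \<open>m\<close>; in the product rule the remaining case carries the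
  coefficient 0.\<close>

lemma diff_single_add:
  fixes m n :: "'v \<Rightarrow>\<^sub>0 nat"
  assumes "Poly_Mapping.lookup m v \<noteq> 0"
  shows "m + n - Poly_Mapping.single v 1 = (m - Poly_Mapping.single v 1) + n"
  by (rule poly_mapping_eqI) (use assms in \<open>auto simp: lookup_add lookup_minus lookup_single when_def\<close>)

lemma partial_deriv_mult [simp]:
  "partial_deriv v (p * q) = partial_deriv v p * q + p * partial_deriv v q"
proof (induction p rule: poly_mapping_single_induct)
  case (single m c)
  show ?case
  proof (induction q rule: poly_mapping_single_induct)
    case (single n d)
    let ?e = "Poly_Mapping.single v 1"
    have "Poly_Mapping.single (m + n - ?e) (of_nat (Poly_Mapping.lookup m v) * c * d) =
        Poly_Mapping.single (m - ?e + n) (of_nat (Poly_Mapping.lookup m v) * c * d)"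
      using diff_single_add[of m v n] by (cases "Poly_Mapping.lookup m v = 0") simp_all
    moreover have "Poly_Mapping.single (m + n - ?e) (of_nat (Poly_Mapping.lookup n v) * c * d) =
        Poly_Mapping.single (m + (n - ?e)) (of_nat (Poly_Mapping.lookup n v) * c * d)"
      using diff_single_add[of n v m] by (cases "Poly_Mapping.lookup n v = 0") (simp_all add: add.commute)
    ultimately show ?case
      by (simp add: mult_single partial_deriv_single lookup_add algebra_simps single_add)
  qed (simp add: algebra_simps)
qed (simp add: algebra_simps)

lemma partial_deriv_0 [simp]: "partial_deriv v 0 = 0"
  by (simp add: partial_deriv_def)

lemma partial_deriv_minus [simp]: "partial_deriv v (- p) = - partial_deriv v p"
  using partial_deriv_add[of v p "- p"]
  by (simp del: partial_deriv_add add: eq_neg_iff_add_eq_0 add.commute)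

lemma partial_deriv_diff [simp]: "partial_deriv v (p - q) = partial_deriv v p - partial_deriv v q"
  using partial_deriv_add[of v p "- q"] by (simp del: partial_deriv_add)

lemma partial_deriv_sum: "partial_deriv v (sum g A) = (\<Sum>x\<in>A. partial_deriv v (g x))"
  by (induction A rule: infinite_finite_induct) simp_all

lemma partial_deriv_1 [simp]: "partial_deriv v 1 = 0"
  using partial_deriv_Const[of v 1] by (simp del: partial_deriv_Const)

lemma partial_deriv_of_nat [simp]: "partial_deriv v (of_nat n) = 0"
  by (induction n) simp_all

lemma partial_deriv_numeral [simp]: "partial_deriv v (numeral n) = 0"
  using partial_deriv_of_nat[of v "numeral n"] by (simp del: partial_deriv_of_nat)

lemma partial_deriv_commute:
  "partial_deriv v (partial_deriv w p) = partial_deriv w (partial_deriv v p)"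
  by (induction p rule: mpoly_induct) (simp_all add: partial_deriv_Var algebra_simps)

lemma partial_deriv_subst_Var:
  assumes "inj j"
  shows "partial_deriv (j v) (subst (\<lambda>v. Var (j v)) p) = subst (\<lambda>v. Var (j v)) (partial_deriv v p)"
  by (induction p rule: mpoly_induct) (simp_all add: partial_deriv_Var inj_eq[OF assms])

lemma partial_deriv_subst_Var_0:
  assumes "w \<notin> range j"
  shows "partial_deriv w (subst (\<lambda>v. Var (j v)) p) = 0"
  using assms by (induction p rule: mpoly_induct) (auto simp: partial_deriv_Var)

lemma partial_deriv_map_Const:
  "partial_deriv v (Poly_Mapping.map Const p) = Poly_Mapping.map Const (partial_deriv v p)"
  by (induction p rule: mpoly_induct) (simp_all add: partial_deriv_Var)

subsection \<open>The second transvectant\<close>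

text \<open>The even permutations are the three cyclic shifts, and exchanging the first two entries
  of each gives the odd ones.\<close>

lemma Omega_expand:
  "Omega F =
    (\<Sum>(i, j, k)\<in>{(1, 2, 3), (2, 3, 1), (3, 1, 2)}.
       partial_deriv (X i) (partial_deriv (Y j) (partial_deriv (Z k) F)) -
       partial_deriv (X j) (partial_deriv (Y i) (partial_deriv (Z k) F)))"
proof -
  have f123: "finite {2::3, 3}" "1 \<notin> {2::3, 3}"
    and f23: "finite {3::3}" "2 \<notin> {3::3}"
    by auto
  show ?thesis
    unfolding Omega_def UNIV_3
    unfolding sum_over_permutations_insert[OF f123]
    unfolding sum_over_permutations_insert[OF f23]
    unfolding permutes_sing
    by (simp add: sign_swap_id permutation_swap_id sign_compose sign_id algebra_simps)
qed

definition subst_X :: "(3, 'a::comm_ring_1) mpoly \<Rightarrow> (xyz, 'a) mpoly" where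
  "subst_X = subst (\<lambda>i. Var (X i))"
definition subst_Y :: "(3, 'a::comm_ring_1) mpoly \<Rightarrow> (xyz, 'a) mpoly" where
  "subst_Y = subst (\<lambda>i. Var (Y i))"
definition subst_Z :: "(3, 'a::comm_ring_1) mpoly \<Rightarrow> (xyz, 'a) mpoly" where
  "subst_Z = subst (\<lambda>i. Var (Z i))"

lemma partial_deriv_subst_XYZ [simp]:
  "partial_deriv (X i) (subst_X f) = subst_X (partial_deriv i f)"
  "partial_deriv (Y i) (subst_Y f) = subst_Y (partial_deriv i f)"
  "partial_deriv (Z i) (subst_Z f) = subst_Z (partial_deriv i f)"
  "partial_deriv (Y i) (subst_X f) = 0" "partial_deriv (Z i) (subst_X f) = 0"
  "partial_deriv (X i) (subst_Y f) = 0" "partial_deriv (Z i) (subst_Y f) = 0"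
  "partial_deriv (X i) (subst_Z f) = 0" "partial_deriv (Y i) (subst_Z f) = 0"
  unfolding subst_X_def subst_Y_def subst_Z_def
  by (auto intro!: partial_deriv_subst_Var partial_deriv_subst_Var_0 injI)

text \<open>Each factor involves its own triple of variables, so the result is again a sum of
  separated products and \<open>Omega\<close> can be applied once more.\<close>

lemma Omega_subst_XYZ:
  "Omega (subst_X f * subst_Y g * subst_Z h) =
    (\<Sum>(i, j, k)\<in>{(1, 2, 3), (2, 3, 1), (3, 1, 2)}.
       subst_X (partial_deriv i f) * subst_Y (partial_deriv j g) * subst_Z (partial_deriv k h) -
       subst_X (partial_deriv j f) * subst_Y (partial_deriv i g) * subst_Z (partial_deriv k h))"
  by (simp add: Omega_expand)

lemma Omega_add: "Omega (F + G) = Omega F + Omega G"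
  and Omega_diff: "Omega (F - G) = Omega F - Omega G"
  by (simp_all add: Omega_expand)

definition diag_xyz :: "(xyz, 'a::comm_ring_1) mpoly \<Rightarrow> (3, 'a) mpoly" where
  "diag_xyz = subst (\<lambda>v. case v of X i \<Rightarrow> Var i | Y i \<Rightarrow> Var i | Z i \<Rightarrow> Var i)"

lemma diag_xyz_subst [simp]:
  "diag_xyz (subst_X f) = f" "diag_xyz (subst_Y f) = f" "diag_xyz (subst_Z f) = f"
  by (simp_all add: diag_xyz_def subst_X_def subst_Y_def subst_Z_def subst_subst_Var)

interpretation diag_xyz: comm_ring_hom diag_xyz
  unfolding diag_xyz_def by (rule subst.comm_ring_hom_axioms)

text \<open>For symmetric \<open>h\<close>, this is the value at \<open>u\<close> of the quadratic form given by the adjugate of \<open>h\<close>.\<close>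

definition adj_form :: "(3 \<Rightarrow> 3 \<Rightarrow> 'a::comm_ring_1) \<Rightarrow> (3 \<Rightarrow> 'a) \<Rightarrow> 'a" where
  "adj_form h u =
    (h 2 2 * h 3 3 - h 2 3 ^ 2) * u 1 ^ 2 +
    (h 1 1 * h 3 3 - h 1 3 ^ 2) * u 2 ^ 2 +
    (h 1 1 * h 2 2 - h 1 2 ^ 2) * u 3 ^ 2 +
    2 * ((h 1 3 * h 2 3 - h 1 2 * h 3 3) * u 1 * u 2 +
         (h 1 2 * h 2 3 - h 1 3 * h 2 2) * u 1 * u 3 +
         (h 1 2 * h 1 3 - h 2 3 * h 1 1) * u 2 * u 3)"

lemma (in comm_ring_hom) hom_adj_form:
  "\<phi> (adj_form h u) = adj_form (\<lambda>i j. \<phi> (h i j)) (\<lambda>i. \<phi> (u i))"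
  by (simp add: adj_form_def)

lemma partial_deriv_u_x_square:
  "partial_deriv i (partial_deriv j (u_x ^ 2)) = 2 * Const (Var i) * Const (Var j)"
proof -
  have "partial_deriv i u_x = Const (Var i)" for i
    by (simp add: u_x_def partial_deriv_sum partial_deriv_Var if_distrib cong: if_cong)
  then show ?thesis by (simp add: power2_eq_square)
qed

text \<open>\<open>Omega\<close> applied twice differentiates each factor twice, so \<open>h\<close>
  enters only through its Hessian. Contracting two copies of the Hessian of \<open>f\<close> gives
  twice its adjugate; the other factor 2 comes from \<open>h\<close>.\<close>

lemma transvectant_2_eq:
  fixes f :: "(3, 'a::comm_ring_1) mpoly"
  assumes h: "\<And>i j. partial_deriv i (partial_deriv j h) = 2 * u i * u j"
  shows "transvectant 2 f f h = 4 * adj_form (\<lambda>i j. partial_deriv i (partial_deriv j f)) u"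
proof -
  have sym: "partial_deriv 2 (partial_deriv 1 f) = partial_deriv 1 (partial_deriv 2 f)"
    "partial_deriv 3 (partial_deriv 1 f) = partial_deriv 1 (partial_deriv 3 f)"
    "partial_deriv 3 (partial_deriv 2 f) = partial_deriv 2 (partial_deriv 3 f)"
    by (rule partial_deriv_commute)+
  have "transvectant 2 f f h = diag_xyz (Omega (Omega (subst_X f * subst_Y f * subst_Z h)))"
    by (simp add: transvectant_def diag_xyz_def subst_X_def subst_Y_def subst_Z_def
        numeral_2_eq_2)
  also have "\<dots> = 4 * adj_form (\<lambda>i j. partial_deriv i (partial_deriv j f)) u"
    by (simp add: Omega_subst_XYZ Omega_add Omega_diff h sym adj_form_def)
       (simp add: algebra_simps power2_eq_square)
  finally show ?thesis .
qed

text \<open>The factor 1/4 in \<open>theta\<close> cancels the 4 of the transvectant.\<close>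

lemma theta_eq_adj_form:
  "theta f = adj_form (\<lambda>i j. Poly_Mapping.map Const (partial_deriv i (partial_deriv j f)))
     (\<lambda>i. Const (Var i))"
proof -
  have "Const (Const (1 / 4)) * 4 = (1 :: (3, (3, complex) mpoly) mpoly)"
    by (metis Const.hom_mult Const.hom_numeral Const_1 nonzero_divide_eq_eq zero_neq_numeral)
  then show ?thesis
    unfolding theta_def transvectant_2_eq[OF partial_deriv_u_x_square]
    by (simp add: partial_deriv_map_Const flip: mult.assoc)
qed

text \<open>Cauchy-Binet: the Gram determinant of \<open>a\<close> and \<open>b\<close> under
  \<open>h\<close> pairs the 2x2 minors of \<open>h\<close>, which form the adjugate up to sign,
  with those of \<open>a\<close> and \<open>b\<close>, which are the coordinates of the cross
  product \<open>u\<close> up to sign.\<close>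

lemma adj_form_cross:
  fixes h :: "3 \<Rightarrow> 3 \<Rightarrow> 'a::comm_ring_1"
  defines "H \<equiv> \<lambda>x y. \<Sum>i\<in>UNIV. \<Sum>j\<in>UNIV. h i j * x i * y j"
  assumes sym: "\<And>i j. h i j = h j i"
    and u: "u 1 = a 2 * b 3 - a 3 * b 2" "u 2 = a 3 * b 1 - a 1 * b 3" "u 3 = a 1 * b 2 - a 2 * b 1"
  shows "adj_form h u = H a a * H b b - H a b ^ 2"
proof -
  have "h 2 1 = h 1 2" "h 3 1 = h 1 3" "h 3 2 = h 2 3"
    by (rule sym)+
  then show ?thesis
    unfolding H_def adj_form_def u sum_3 by (simp add: algebra_simps power2_eq_square)
qed

subsection \<open>The Euler operator\<close>

text \<open>A derivation that multiplies each monomial by its degree; it turns homogeneity into an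
  eigenvalue equation.\<close>

definition euler :: "(3, 'a::comm_ring_1) mpoly \<Rightarrow> (3, 'a) mpoly" where
  "euler p = (\<Sum>i\<in>UNIV. Var i * partial_deriv i p)"

lemma euler_add: "euler (p + q) = euler p + euler q"
  by (simp add: euler_def algebra_simps sum.distrib)

lemma euler_mult: "euler (p * q) = euler p * q + p * euler q"
  by (simp add: euler_def algebra_simps sum.distrib sum_distrib_left sum_distrib_right)

lemma euler_Const [simp]: "euler (Const c) = 0"
  by (simp add: euler_def)

lemma euler_Var [simp]: "euler (Var i) = Var i"
  by (simp add: euler_def partial_deriv_Var if_distrib cong: if_cong)

text \<open>The commutator of \<open>partial_deriv i\<close> with \<open>euler\<close> is
  \<open>partial_deriv i\<close> itself; this is why differentiation lowers the degree by
  one.\<close>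

lemma euler_partial_deriv: "euler (partial_deriv i p) = partial_deriv i (euler p) - partial_deriv i p"
proof -
  have "partial_deriv i (euler p) =
      (\<Sum>j\<in>UNIV. (if i = j then 1 else 0) * partial_deriv j p + Var j * partial_deriv i (partial_deriv j p))"
    by (simp add: euler_def partial_deriv_sum partial_deriv_Var)
  also have "\<dots> = partial_deriv i p + (\<Sum>j\<in>UNIV. Var j * partial_deriv i (partial_deriv j p))"
    by (simp add: sum.distrib if_distrib[of "\<lambda>x. x * _"] cong: if_cong)
  finally show ?thesis by (simp add: euler_def partial_deriv_commute[of i])
qed

lemma euler_single:
  "euler (Poly_Mapping.single m c) =
    Poly_Mapping.single m (of_nat (\<Sum>i\<in>UNIV. Poly_Mapping.lookup m i) * c)"
proof -
  have "Var i * partial_deriv i (Poly_Mapping.single m c) =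
      Poly_Mapping.single m (of_nat (Poly_Mapping.lookup m i) * c)" for i
  proof (cases "Poly_Mapping.lookup m i = 0")
    case False
    then have "Poly_Mapping.single i 1 + (m - Poly_Mapping.single i 1) = m"
      by (intro poly_mapping_eqI) (auto simp: lookup_add lookup_minus lookup_single when_def)
    then show ?thesis by (simp add: partial_deriv_single Var_def mult_single)
  qed (simp add: partial_deriv_single)
  then show ?thesis by (simp add: euler_def sum_3 single_add algebra_simps)
qed

lemma lookup_euler:
  "Poly_Mapping.lookup (euler p) m =
    of_nat (\<Sum>i\<in>UNIV. Poly_Mapping.lookup m i) * Poly_Mapping.lookup p m"
proof (induction p rule: poly_mapping_single_induct)
  case (single k c)
  then show ?case by (auto simp: euler_single lookup_single when_def)
qed (simp add: euler_add lookup_add algebra_simps)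

text \<open>Monomials are eigenvectors of \<open>euler\<close>; cancelling a nonzero coefficient and
  injectivity of \<open>of_nat\<close> identify the eigenvalue with the degree.\<close>

lemma is_form_iff_euler:
  fixes p :: "(3, 'a::{idom, ring_char_0}) mpoly"
  shows "is_form d p \<longleftrightarrow> euler p = of_nat d * p"
proof -
  have "Poly_Mapping.lookup (of_nat d * p) m = of_nat d * Poly_Mapping.lookup p m" for m
    by (induction d) (simp_all add: lookup_add algebra_simps)
  then have "euler p = of_nat d * p \<longleftrightarrow>
      (\<forall>m. of_nat (\<Sum>i\<in>UNIV. Poly_Mapping.lookup m i) * Poly_Mapping.lookup p m =
        of_nat d * Poly_Mapping.lookup p m)"
    by (simp only: poly_mapping_eq_iff fun_eq_iff lookup_euler)
  also have "\<dots> \<longleftrightarrow> is_form d p"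
    by (auto simp: is_form_def Ball_def in_keys_iff simp del: of_nat_sum)
  finally show ?thesis ..
qed

lemma is_form_partial_deriv:
  fixes p :: "(3, 'a::{idom, ring_char_0}) mpoly"
  assumes "is_form (Suc d) p"
  shows "is_form d (partial_deriv i p)"
  using assms by (simp add: is_form_iff_euler euler_partial_deriv algebra_simps)

lemma is_form_add:
  fixes p q :: "(3, 'a::{idom, ring_char_0}) mpoly"
  shows "is_form d p \<Longrightarrow> is_form d q \<Longrightarrow> is_form d (p + q)"
  by (simp add: is_form_iff_euler euler_add algebra_simps)

lemma is_form_mult:
  fixes p q :: "(3, 'a::{idom, ring_char_0}) mpoly"
  shows "is_form d p \<Longrightarrow> is_form e q \<Longrightarrow> is_form (d + e) (p * q)"
  by (simp add: is_form_iff_euler euler_mult algebra_simps)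

lemma is_form_0_Const: "is_form 0 (Const c)"
  for c :: "'a::{idom, ring_char_0}"
  by (simp add: is_form_iff_euler)

lemma is_form_1_Var: "is_form 1 (Var i :: (3, 'a::{idom, ring_char_0}) mpoly)"
  by (simp add: is_form_iff_euler)

lemma is_form_Const_mult: "is_form d p \<Longrightarrow> is_form d (Const c * p)"
  for c :: "'a::{idom, ring_char_0}"
  using is_form_mult[OF is_form_0_Const] by fastforce

lemma is_form_zero: "is_form d 0"
  by (simp add: is_form_def)

lemma is_form_sum:
  fixes g :: "'i \<Rightarrow> (3, 'a::{idom, ring_char_0}) mpoly"
  shows "(\<And>i. i \<in> A \<Longrightarrow> is_form d (g i)) \<Longrightarrow> is_form d (sum g A)"
  by (induction A rule: infinite_finite_induct) (simp_all add: is_form_zero is_form_add)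

lemma is_form_uminus:
  fixes p :: "(3, 'a::{idom, ring_char_0}) mpoly"
  shows "is_form d p \<Longrightarrow> is_form d (- p)"
  using is_form_Const_mult[of d p "- 1"] by (simp add: Const.hom_minus)

lemma is_form_diff:
  fixes p q :: "(3, 'a::{idom, ring_char_0}) mpoly"
  shows "is_form d p \<Longrightarrow> is_form d q \<Longrightarrow> is_form d (p - q)"
  using is_form_add[of d p "- q"] by (simp add: is_form_uminus)

lemma is_form_0_eq_Const:
  assumes "is_form 0 p"
  obtains c where "p = Const c"
proof
  have "Poly_Mapping.lookup p m = 0" if "m \<noteq> 0" for m
  proof (rule ccontr)
    assume "Poly_Mapping.lookup p m \<noteq> 0"
    then have "(\<Sum>i\<in>UNIV. Poly_Mapping.lookup m i) = 0"
      using assms unfolding is_form_def Ball_def in_keys_iff by blast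
    then have "m = 0" by (intro poly_mapping_eqI) simp
    with that show False ..
  qed
  then show "p = Const (Poly_Mapping.lookup p 0)"
    by (intro poly_mapping_eqI) (auto simp: Const_def lookup_single when_def)
qed

lemma partial_deriv_partial_deriv_linear:
  fixes a :: "(3, 'a::{idom, ring_char_0}) mpoly"
  assumes "is_form 1 a"
  shows "partial_deriv i (partial_deriv j a) = 0"
  using assms is_form_partial_deriv[of 0 a j] by (auto elim!: is_form_0_eq_Const)

subsection \<open>Coefficients of ternary cubics\<close>

text \<open>Third derivatives of a cubic form are constants, read off at exponent 0. Dividing by 3!
  makes these the entries of the symmetric tensor representing \<open>f\<close>.\<close>

definition cubic_coeff :: "(3, complex) mpoly \<Rightarrow> 3 \<Rightarrow> 3 \<Rightarrow> 3 \<Rightarrow> complex" where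
  "cubic_coeff f i j k =
    Poly_Mapping.lookup (partial_deriv i (partial_deriv j (partial_deriv k f))) 0 / 6"

lemma cubic_coeff_commute:
  "cubic_coeff f i j k = cubic_coeff f j i k" "cubic_coeff f i j k = cubic_coeff f i k j"
  unfolding cubic_coeff_def by (metis partial_deriv_commute)+

context
  fixes f :: "(3, complex) mpoly"
  assumes form: "is_form 3 f"
begin

lemma partial_deriv_cubic_1: "is_form 2 (partial_deriv k f)"
  and partial_deriv_cubic_2: "is_form 1 (partial_deriv j (partial_deriv k f))"
  and partial_deriv_cubic_3: "is_form 0 (partial_deriv i (partial_deriv j (partial_deriv k f)))"
proof -
  show 1: "is_form 2 (partial_deriv k f)" for k
    using form is_form_partial_deriv[of 2 f] by simp
  show 2: "is_form 1 (partial_deriv j (partial_deriv k f))" for j k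
    using 1[of k] is_form_partial_deriv[of 1] by (simp add: numeral_2_eq_2)
  show "is_form 0 (partial_deriv i (partial_deriv j (partial_deriv k f)))"
    using 2[of j k] is_form_partial_deriv[of 0] by simp
qed

text \<open>Euler's identity in degree 1: a linear form is recovered from its first derivatives,
  here the third derivatives of \<open>f\<close>.\<close>

lemma hessian_cubic_eq:
  "partial_deriv j (partial_deriv k f) = (\<Sum>i\<in>UNIV. Const (6 * cubic_coeff f i j k) * Var i)"
proof -
  have c: "partial_deriv i (partial_deriv j (partial_deriv k f)) = Const (6 * cubic_coeff f i j k)" for i
    using partial_deriv_cubic_3[of i j k]
    by (elim is_form_0_eq_Const) (simp add: cubic_coeff_def Const_def)
  have "partial_deriv j (partial_deriv k f) = euler (partial_deriv j (partial_deriv k f))"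
    using partial_deriv_cubic_2[of j k] by (simp add: is_form_iff_euler)
  then show ?thesis
    by (simp add: euler_def[of "partial_deriv j (partial_deriv k f)"] c mult.commute)
qed

text \<open>Euler's identity in degrees 3 and 2 expresses \<open>6 * f\<close> through the Hessian,
  whose coefficients carry the same factor 6.\<close>

lemma cubic_form_expansion:
  "f = (\<Sum>k\<in>UNIV. \<Sum>j\<in>UNIV. \<Sum>i\<in>UNIV. Const (cubic_coeff f i j k) * Var i * Var j * Var k)"
proof -
  have 3: "3 * f = euler f" and 2: "2 * partial_deriv k f = euler (partial_deriv k f)" for k
    using form partial_deriv_cubic_1 by (simp_all add: is_form_iff_euler)
  have "6 * f = 2 * (\<Sum>k\<in>UNIV. Var k * partial_deriv k f)"
    using 3 by (simp add: euler_def)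
  also have "\<dots> = (\<Sum>k\<in>UNIV. Var k * (2 * partial_deriv k f))"
    by (simp add: sum_distrib_left mult.left_commute)
  also have "\<dots> = (\<Sum>k\<in>UNIV. Var k * (\<Sum>j\<in>UNIV. Var j * partial_deriv j (partial_deriv k f)))"
    by (simp only: 2 euler_def)
  also have "\<dots> = (\<Sum>k\<in>UNIV. \<Sum>j\<in>UNIV. \<Sum>i\<in>UNIV.
      6 * (Const (cubic_coeff f i j k) * Var i * Var j * Var k))"
    unfolding hessian_cubic_eq sum_distrib_left
    by (intro sum.cong refl) (simp add: Const_mult)
  also have "\<dots> = 6 * (\<Sum>k\<in>UNIV. \<Sum>j\<in>UNIV. \<Sum>i\<in>UNIV.
      Const (cubic_coeff f i j k) * Var i * Var j * Var k)"
    by (simp only: sum_distrib_left)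
  finally have "Const (1 / 6) * (6 * f) = Const (1 / 6) * (6 * (\<Sum>k\<in>UNIV. \<Sum>j\<in>UNIV. \<Sum>i\<in>UNIV.
      Const (cubic_coeff f i j k) * Var i * Var j * Var k))"
    by simp
  moreover have "Const (1 / 6) * 6 = (1 :: (3, complex) mpoly)"
    by (metis Const.hom_mult Const.hom_numeral Const_1 nonzero_divide_eq_eq zero_neq_numeral)
  ultimately show ?thesis by (simp flip: mult.assoc)
qed

end

subsection \<open>Symmetric trilinear forms\<close>

text \<open>Linearity is stated in the first argument; symmetry carries it to the others.\<close>

locale symmetric_trilinear =
  fixes T :: "('i \<Rightarrow> 'a) \<Rightarrow> ('i \<Rightarrow> 'a) \<Rightarrow> ('i \<Rightarrow> 'a) \<Rightarrow> 'a::field_char_0"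
  assumes add1: "T (\<lambda>i. x i + y i) z w = T x z w + T y z w"
    and scale1: "T (\<lambda>i. c * x i) z w = c * T x z w"
    and commute12: "T x y z = T y x z"
    and commute23: "T x y z = T x z y"
begin

lemma add2: "T z (\<lambda>i. x i + y i) w = T z x w + T z y w"
  by (metis add1 commute12)

lemma add3: "T z w (\<lambda>i. x i + y i) = T z w x + T z w y"
  by (metis add2 commute23)

lemma scale2: "T z (\<lambda>i. c * x i) w = c * T z x w"
  by (metis scale1 commute12)

lemma scale3: "T z w (\<lambda>i. c * x i) = c * T z w x"
  by (metis scale2 commute23)

text \<open>Polarization: expanding the cubic at \<open>x + y + z\<close> leaves
  \<open>6 * T x y z\<close> and terms in pairs of arguments, which vanish by the same expansion at
  \<open>a + b\<close>.\<close>

lemma eq_0_if_cubic_eq_0: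
  assumes "\<And>x. T x x x = 0"
  shows "T x y z = 0"
proof -
  have pair: "T a a b + T a b b = 0" for a b
  proof -
    have "0 = T (\<lambda>i. a i + b i) (\<lambda>i. a i + b i) (\<lambda>i. a i + b i)"
      by (simp only: assms)
    also have "\<dots> = 3 * (T a a b + T a b b)"
      using assms by (simp add: add1 add2 add3 commute12[of b a] commute23[of _ b a])
    finally show ?thesis by (metis mult_eq_0_iff zero_neq_numeral)
  qed
  have "0 = T (\<lambda>i. (x i + y i) + z i) (\<lambda>i. (x i + y i) + z i) (\<lambda>i. (x i + y i) + z i)"
    by (simp only: assms)
  also have "\<dots> = 3 * (T x x y + T x y y) + 3 * (T x x z + T x z z) + 3 * (T y y z + T y z z) +
      6 * T x y z"
    using assms
    by (simp add: add1[of "\<lambda>i. x i + y i"] add2[of _ "\<lambda>i. x i + y i"] add3[of _ _ "\<lambda>i. x i + y i"]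
        add1 add2 add3 commute12[of y x] commute12[of z x] commute12[of z y]
        commute23[of _ y x] commute23[of _ z x] commute23[of _ z y])
  also have "\<dots> = 6 * T x y z"
    by (simp only: pair) simp
  finally show ?thesis by simp
qed

lemma cubic_eq_power_3:
  assumes rank: "\<And>v a b. T v a a * T v b b = (T v a b)\<^sup>2"
    and v: "T v v v = 1"
  shows "T y y y = T v v y ^ 3"
proof -
  let ?l = "T v v y" and ?q = "T v y y" and ?F = "T y y y"
  have q: "?q = ?l\<^sup>2"
    using rank[of v y v] by (simp add: v commute23[of v y v])
  have F: "?F * ?l = ?q\<^sup>2"
    using rank[of y y v] by (simp add: commute12[of y v] commute23[of y y v] commute23[of v y v])
  \<comment> \<open>The relation at \<open>y\<close> determines \<open>?F\<close> only where
    \<open>?l\<close> is nonzero. At \<open>v + y\<close>, substituting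
    \<open>?q = ?l\<^sup>2\<close> and \<open>?F * ?l = ?q\<^sup>2\<close> cancels everything except
    \<open>?F = ?l * ?q\<close>.\<close>
  have "(?q + ?F) * (1 + ?l) = (?l + ?q)\<^sup>2"
    using rank[of "\<lambda>i. v i + y i" y v]
    by (simp add: add1 v commute12[of y v] commute23[of y y v] commute23[of v y v])
  then have "?F = ?l * ?q"
    using F q by algebra
  with q show ?thesis by (simp add: power2_eq_square power3_eq_cube)
qed

end

section \<open>The polar form of a ternary cubic\<close>

definition cubic_polar ::
    "(3, complex) mpoly \<Rightarrow> (3 \<Rightarrow> complex) \<Rightarrow> (3 \<Rightarrow> complex) \<Rightarrow> (3 \<Rightarrow> complex) \<Rightarrow> complex" where
  "cubic_polar f x y z =
    (\<Sum>k\<in>UNIV. \<Sum>j\<in>UNIV. \<Sum>i\<in>UNIV. cubic_coeff f i j k * x i * y j * z k)"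

interpretation cubic_polar: symmetric_trilinear "cubic_polar f" for f
proof
  fix x y z :: "3 \<Rightarrow> complex"
  show "cubic_polar f x y z = cubic_polar f y x z"
    unfolding cubic_polar_def
    by (rule sum.cong[OF refl], subst sum.swap) (simp add: cubic_coeff_commute(1)[of f] mult_ac)
  show "cubic_polar f x y z = cubic_polar f x z y"
    unfolding cubic_polar_def
    by (subst sum.swap) (simp add: cubic_coeff_commute(2)[of f] mult_ac)
qed (simp_all add: cubic_polar_def algebra_simps sum.distrib sum_distrib_left)

abbreviation unit_vec :: "3 \<Rightarrow> 3 \<Rightarrow> complex" where
  "unit_vec i \<equiv> \<lambda>j. if j = i then 1 else 0"

lemma cubic_polar_unit_vec3:
  "cubic_polar f x y (unit_vec k) = (\<Sum>j\<in>UNIV. \<Sum>i\<in>UNIV. cubic_coeff f i j k * x i * y j)"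
proof -
  have "(\<Sum>j\<in>UNIV. \<Sum>i\<in>UNIV. cubic_coeff f i j l * x i * y j * unit_vec k l) =
      (if l = k then \<Sum>j\<in>UNIV. \<Sum>i\<in>UNIV. cubic_coeff f i j k * x i * y j else 0)" for l
    by simp
  then show ?thesis by (simp add: cubic_polar_def)
qed

text \<open>With \<open>v\<close> in the first two arguments, this gives the coefficients of the
  linear form whose cube will be \<open>f\<close>.\<close>

lemma cubic_polar_eq_sum: "cubic_polar f x y z = (\<Sum>i\<in>UNIV. cubic_polar f x y (unit_vec i) * z i)"
  unfolding cubic_polar_unit_vec3 by (simp add: cubic_polar_def sum_distrib_right)

lemma cubic_polar_unit_vec: "cubic_polar f (unit_vec i) (unit_vec j) (unit_vec k) = cubic_coeff f i j k"
proof -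
  have "(\<Sum>i'\<in>UNIV. cubic_coeff f i' j' k * unit_vec i i' * unit_vec j j') =
      (if j' = j then cubic_coeff f i j k else 0)" for j'
    by (simp add: if_distrib[of "\<lambda>x. _ * x"] cong: if_cong)
  then show ?thesis unfolding cubic_polar_unit_vec3 by simp
qed

interpretation eval: comm_ring_hom "mpoly_eval (\<lambda>c. c) v" for v
  by (intro comm_ring_hom_mpoly_eval comm_ring_hom_id)

lemma eval_Const [simp]: "mpoly_eval (\<lambda>c. c) v (Const c) = c"
  and eval_Var [simp]: "mpoly_eval (\<lambda>c. c) v (Var i) = v i"
  by (simp_all add: mpoly_eval_Const mpoly_eval_Var comm_ring_hom_id)

lemma eval_cubic_form:
  fixes f :: "(3, complex) mpoly"
  assumes "is_form 3 f"
  shows "mpoly_eval (\<lambda>c. c) v f = cubic_polar f v v v"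
  by (subst cubic_form_expansion[OF assms]) (simp add: cubic_polar_def eval.hom_sum)

text \<open>Vanishing as a function kills the polar form by polarization, and its values at unit
  vectors are the coefficients of \<open>f\<close>.\<close>

lemma cubic_form_eq_0:
  fixes f :: "(3, complex) mpoly"
  assumes "is_form 3 f" and "\<And>v. mpoly_eval (\<lambda>c. c) v f = 0"
  shows "f = 0"
proof -
  have "cubic_polar f x y z = 0" for x y z
    by (rule cubic_polar.eq_0_if_cubic_eq_0) (simp add: assms flip: eval_cubic_form)
  then have "cubic_coeff f i j k = 0" for i j k
    by (simp flip: cubic_polar_unit_vec)
  then show ?thesis
    by (subst cubic_form_expansion[OF assms(1)]) simp
qed

text \<open>The Hessian of \<open>f\<close> at \<open>v\<close> is 6 times the polar form with
  \<open>v\<close> in the first slot, so \<open>theta f\<close> at \<open>x = v\<close> and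
  \<open>u = a \<times> b\<close> is 36 times the difference of the two sides.\<close>

lemma cubic_polar_if_theta_eq_0:
  assumes form: "is_form 3 f" and theta: "theta f = 0"
  shows "cubic_polar f v a a * cubic_polar f v b b = (cubic_polar f v a b)\<^sup>2"
proof -
  \<comment> \<open>The cross product of \<open>a\<close> and \<open>b\<close>; the last branch is
    the index 3.\<close>
  define u :: "3 \<Rightarrow> complex" where
    "u i = (if i = 1 then a 2 * b 3 - a 3 * b 2
      else if i = 2 then a 3 * b 1 - a 1 * b 3 else a 1 * b 2 - a 2 * b 1)" for i
  define h where "h i j = mpoly_eval (\<lambda>c. c) v (partial_deriv i (partial_deriv j f))" for i j
  \<comment> \<open>The inner evaluation substitutes for the \<open>u\<close> variables in the
    coefficients, the outer one for the \<open>x\<close> variables.\<close>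
  define \<psi> :: "(3, (3, complex) mpoly) mpoly \<Rightarrow> complex"
    where "\<psi> = mpoly_eval (mpoly_eval (\<lambda>c. c) u) v"
  interpret \<psi>: comm_ring_hom \<psi>
    unfolding \<psi>_def by (intro comm_ring_hom_mpoly_eval comm_ring_hom_id)
  have \<psi>_Const: "\<psi> (Const q) = mpoly_eval (\<lambda>c. c) u q" and \<psi>_Var: "\<psi> (Var i) = v i" for q i
    unfolding \<psi>_def by (intro mpoly_eval_Const mpoly_eval_Var comm_ring_hom_mpoly_eval comm_ring_hom_id)+
  \<comment> \<open>Both sides are ring homomorphisms in \<open>q\<close> that agree on constants
    and variables.\<close>
  have "\<psi> (Poly_Mapping.map Const q) = mpoly_eval (\<lambda>c. c) v q" for q
    by (rule mpoly_hom_eq[OF comm_ring_hom_comp[OF map_Const.comm_ring_hom_axioms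
          \<psi>.comm_ring_hom_axioms] eval.comm_ring_hom_axioms])
      (simp_all add: \<psi>_Const \<psi>_Var)
  then have "adj_form h u = \<psi> (theta f)"
    by (simp add: theta_eq_adj_form \<psi>.hom_adj_form \<psi>_Const h_def[abs_def])
  then have "adj_form h u = 0" by (simp add: theta)
  moreover have "h i j = h j i" for i j
    unfolding h_def by (simp only: partial_deriv_commute)
  moreover have "(\<Sum>i\<in>UNIV. \<Sum>j\<in>UNIV. h i j * x i * y j) = 6 * cubic_polar f v x y" for x y
  proof -
    have "(\<Sum>i\<in>UNIV. \<Sum>j\<in>UNIV. h i j * x i * y j) =
        6 * (\<Sum>i\<in>UNIV. \<Sum>j\<in>UNIV. \<Sum>k\<in>UNIV. cubic_coeff f k i j * v k * x i * y j)"
      by (simp add: h_def hessian_cubic_eq[OF form] eval.hom_sum sum_distrib_left sum_distrib_right mult.assoc)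
    also have "\<dots> = 6 * cubic_polar f v x y"
      unfolding cubic_polar_def by (subst sum.swap) (rule refl)
    finally show ?thesis .
  qed
  ultimately show ?thesis
    using adj_form_cross[of h u a b] by (simp add: u_def power2_eq_square)
qed

section \<open>Cubes of linear forms and the vanishing of theta\<close>

lemma complex_cube_root: "\<exists>r. r ^ 3 = (c :: complex)"
proof
  show "(rcis (root 3 (cmod c)) (Arg c / 3)) ^ 3 = c"
    by (simp add: DeMoivre2 rcis_cmod_Arg)
qed

lemma is_form_power_3:
  fixes a :: "(3, 'a::{idom, ring_char_0}) mpoly"
  shows "is_form 1 a \<Longrightarrow> is_form 3 (a ^ 3)"
  by (simp add: is_form_iff_euler power3_eq_cube euler_mult)

lemma is_form_linear:
  fixes c :: "3 \<Rightarrow> 'a::{idom, ring_char_0}"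
  shows "is_form 1 (\<Sum>i\<in>UNIV. Const (c i) * Var i)"
  by (intro is_form_sum is_form_Const_mult is_form_1_Var)

text \<open>All 2x2 minors of a matrix of rank at most one vanish.\<close>

lemma adj_form_rank_1: "adj_form (\<lambda>i j. c * b i * b j) u = 0"
  unfolding adj_form_def by (simp add: algebra_simps power2_eq_square)

text \<open>Second derivatives of a linear form are zero, so the Hessian of \<open>a ^ 3\<close> is
  \<open>6 * a\<close> times the outer product of the gradient of \<open>a\<close> with
  itself.\<close>

lemma theta_power_3_eq_0:
  assumes "is_form 1 a"
  shows "theta (a ^ 3) = 0"
proof -
  have "partial_deriv i (partial_deriv j (a ^ 3)) = (6 * a) * partial_deriv i a * partial_deriv j a" for i j
    using partial_deriv_partial_deriv_linear[OF assms, of i j] by (simp add: power3_eq_cube algebra_simps)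
  then show ?thesis
    unfolding theta_eq_adj_form map_Const.hom_mult by (simp only: map_Const.hom_mult adj_form_rank_1)
qed

lemma cube_if_theta_eq_0:
  assumes form: "is_form 3 f" and theta: "theta f = 0" and "f \<noteq> 0"
  shows "\<exists>a. is_form 1 a \<and> a \<noteq> 0 \<and> f = a ^ 3"
proof -
  let ?T = "cubic_polar f"
  obtain w where w: "?T w w w \<noteq> 0"
    using cubic_form_eq_0[OF form] \<open>f \<noteq> 0\<close> by (auto simp: eval_cubic_form[OF form])
  obtain r where r: "r ^ 3 = ?T w w w"
    using complex_cube_root by blast
  \<comment> \<open>Scaling by the inverse cube root normalizes the cubic to 1 at \<open>v\<close>;
    \<open>r\<close> is nonzero since its cube is.\<close>
  define v where "v = (\<lambda>i. inverse r * w i)"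
  have "?T v v v = inverse r ^ 3 * ?T w w w"
    unfolding v_def
    by (simp add: cubic_polar.scale1 cubic_polar.scale2 cubic_polar.scale3 power3_eq_cube)
  with w r have "?T v v v = 1"
    by (simp add: power_inverse)
  then have T: "?T y y y = ?T v v y ^ 3" for y
    by (intro cubic_polar.cubic_eq_power_3 cubic_polar_if_theta_eq_0 form theta)
  \<comment> \<open>The linear form \<open>y \<mapsto> ?T v v y\<close>, given by its values on unit
    vectors.\<close>
  define a where "a = (\<Sum>i\<in>UNIV. Const (?T v v (unit_vec i)) * Var i)"
  have a: "is_form 1 a"
    unfolding a_def by (rule is_form_linear)
  \<comment> \<open>By the fact \<open>T\<close> the two cubics agree at every point, hence as
    polynomials.\<close>
  have "f - a ^ 3 = 0"
  proof (rule cubic_form_eq_0)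
    show "is_form 3 (f - a ^ 3)"
      using form a by (intro is_form_diff is_form_power_3)
    show "mpoly_eval (\<lambda>c. c) y (f - a ^ 3) = 0" for y
      using T[of y] cubic_polar_eq_sum[of f v v y]
      by (simp add: eval_cubic_form[OF form] a_def eval.hom_sum)
  qed
  with a \<open>f \<noteq> 0\<close> show ?thesis by auto
qed

subsection \<open>Waring decompositions\<close>

text \<open>The predicate minimized in \<open>waring_rank\<close>, named so that the facts about
  \<open>LEAST\<close> apply to it directly.\<close>

definition waring_decomposable :: "nat \<Rightarrow> (3, complex) mpoly \<Rightarrow> nat \<Rightarrow> bool" where
  "waring_decomposable d f r \<longleftrightarrow>
    (\<exists>l :: nat \<Rightarrow> (3, complex) mpoly. (\<forall>i<r. is_form 1 (l i)) \<and> f = (\<Sum>i<r. l i ^ d))"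

lemma waring_decomposable_0 [simp]: "waring_decomposable d f 0 \<longleftrightarrow> f = 0"
  by (simp add: waring_decomposable_def)

lemma waring_decomposable_1: "waring_decomposable d f 1 \<longleftrightarrow> (\<exists>a. is_form 1 a \<and> f = a ^ d)"
  by (auto simp: waring_decomposable_def)

lemma waring_decomposable_add:
  assumes "waring_decomposable d f r" "waring_decomposable d g s"
  shows "waring_decomposable d (f + g) (r + s)"
proof -
  obtain l m where l: "\<forall>i<r. is_form 1 (l i)" "f = (\<Sum>i<r. l i ^ d)"
    and m: "\<forall>i<s. is_form 1 (m i)" "g = (\<Sum>i<s. m i ^ d)"
    using assms unfolding waring_decomposable_def by blast
  define n where "n i = (if i < r then l i else m (i - r))" for i
  have "(\<Sum>i<r + s. n i ^ d) = (\<Sum>i<r. n i ^ d) + (\<Sum>i<s. n (r + i) ^ d)"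
    by (induction s) (simp_all add: algebra_simps)
  then have "f + g = (\<Sum>i<r + s. n i ^ d)"
    by (simp add: n_def l(2) m(2))
  moreover have "\<forall>i<r + s. is_form 1 (n i)"
    using l(1) m(1) by (auto simp: n_def)
  ultimately show ?thesis unfolding waring_decomposable_def by blast
qed

lemma waring_decomposable_sum:
  assumes "\<And>i. i \<in> A \<Longrightarrow> \<exists>r. waring_decomposable d (g i) r"
  shows "\<exists>r. waring_decomposable d (sum g A) r"
  using assms
proof (induction A rule: infinite_finite_induct)
  case (insert i A)
  then show ?case by (auto intro: waring_decomposable_add)
qed (auto intro: exI[of _ 0])

text \<open>Over the complex numbers the scalar is absorbed into the linear form through a cube
  root.\<close>

lemma waring_decomposable_Const_mult_cube:
  assumes "is_form 1 a"
  shows "waring_decomposable 3 (Const c * a ^ 3) 1"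
proof -
  obtain r where "r ^ 3 = c"
    using complex_cube_root by blast
  then have "Const c * a ^ 3 = (Const r * a) ^ 3"
    by (auto simp: power_mult_distrib)
  with is_form_Const_mult[OF assms] show ?thesis
    unfolding waring_decomposable_1 by blast
qed

text \<open>A polarization identity, exhibiting a product of three factors as a combination of four
  cubes.\<close>

lemma sum_cubes_eq_24_product:
  fixes x y z :: "'a::comm_ring_1"
  shows "(x + y + z) ^ 3 - (x + y - z) ^ 3 - (x - y + z) ^ 3 + (x - y - z) ^ 3 = 24 * x * y * z"
  by (simp add: power3_eq_cube algebra_simps)

text \<open>The four signed sums of the variables are linear forms, and division by 24 takes place
  in the constant. The indices may coincide.\<close>

lemma waring_decomposable_monomial:
  "\<exists>r. waring_decomposable 3 (Const c * Var i * Var j * Var k) r"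
proof -
  define x y z :: "(3, complex) mpoly" where "x = Var i" and "y = Var j" and "z = Var k"
  let ?d = "c / 24"
  have 24: "Const ?d * 24 = (Const c :: (3, complex) mpoly)"
    by (metis Const.hom_mult Const.hom_numeral nonzero_divide_eq_eq zero_neq_numeral)
  have "Const ?d * (x + y + z) ^ 3 + Const (- ?d) * (x + y - z) ^ 3 +
      Const (- ?d) * (x - y + z) ^ 3 + Const ?d * (x - y - z) ^ 3 =
      Const ?d * ((x + y + z) ^ 3 - (x + y - z) ^ 3 - (x - y + z) ^ 3 + (x - y - z) ^ 3)"
    unfolding Const.hom_minus
    by (simp only: distrib_left right_diff_distrib mult_minus_left add_uminus_conv_diff)
  also have "\<dots> = Const c * x * y * z"
    unfolding sum_cubes_eq_24_product by (simp only: 24 mult.assoc[symmetric])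
  finally have "Const c * x * y * z =
      Const ?d * (x + y + z) ^ 3 + Const (- ?d) * (x + y - z) ^ 3 +
      Const (- ?d) * (x - y + z) ^ 3 + Const ?d * (x - y - z) ^ 3" ..
  moreover have "is_form 1 x" "is_form 1 y" "is_form 1 z"
    unfolding x_def y_def z_def by (rule is_form_1_Var)+
  ultimately show ?thesis
    unfolding x_def[symmetric] y_def[symmetric] z_def[symmetric]
    by (metis waring_decomposable_add waring_decomposable_Const_mult_cube is_form_add is_form_diff)
qed

text \<open>
  Without the existence of a decomposition, the \<open>LEAST\<close> in the definition of the rank would be
  unspecified and could be \<open>1\<close>.
\<close>

lemma waring_decomposable_cubic_form:
  assumes "is_form 3 f"
  shows "\<exists>r. waring_decomposable 3 f r"
  by (subst cubic_form_expansion[OF assms]) (intro waring_decomposable_sum waring_decomposable_monomial)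

theorem lemma5p1:
  fixes f :: "(3, complex) mpoly"
  assumes "is_form 3 f"
  shows "((theta f = 0 \<and> f \<noteq> 0) \<longleftrightarrow> (\<exists>a. is_form 1 a \<and> a \<noteq> 0 \<and> f = a ^ 3)) \<and>
         ((\<exists>a. is_form 1 a \<and> a \<noteq> 0 \<and> f = a ^ 3) \<longleftrightarrow> waring_rank 3 f = 1)"
proof -
  have rank: "waring_rank 3 f = (LEAST r. waring_decomposable 3 f r)"
    by (simp add: waring_rank_def waring_decomposable_def)
  \<comment> \<open>Rank one means that one cube suffices while the empty sum, which represents only
    0, does not.\<close>
  have "waring_rank 3 f = 1 \<longleftrightarrow> waring_decomposable 3 f 1 \<and> f \<noteq> 0"
  proof
    assume 1: "waring_rank 3 f = 1"
    have "waring_decomposable 3 f (waring_rank 3 f)"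
      unfolding rank using waring_decomposable_cubic_form[OF assms] by (rule LeastI_ex)
    moreover have "\<not> waring_decomposable 3 f 0"
      using not_less_Least[of 0 "waring_decomposable 3 f"] 1 rank by simp
    ultimately show "waring_decomposable 3 f 1 \<and> f \<noteq> 0"
      using 1 by simp
  next
    assume *: "waring_decomposable 3 f 1 \<and> f \<noteq> 0"
    show "waring_rank 3 f = 1"
      unfolding rank
    proof (rule Least_equality)
      fix r assume "waring_decomposable 3 f r"
      with * show "1 \<le> r" by (cases r) auto
    qed (use * in blast)
  qed
  \<comment> \<open>For \<open>f = a ^ 3\<close>, \<open>f\<close> and \<open>a\<close> vanish
    together, as the polynomial ring has no zero divisors.\<close>
  moreover have "waring_decomposable 3 f 1 \<and> f \<noteq> 0 \<longleftrightarrow> (\<exists>a. is_form 1 a \<and> a \<noteq> 0 \<and> f = a ^ 3)"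
    unfolding waring_decomposable_1 by auto
  moreover have "theta f = 0 \<and> f \<noteq> 0 \<longleftrightarrow> (\<exists>a. is_form 1 a \<and> a \<noteq> 0 \<and> f = a ^ 3)"
    using cube_if_theta_eq_0[OF assms] theta_power_3_eq_0 by auto
  ultimately show ?thesis by simp
qed

end
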